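(* For every finite reduced ring $R\cong\mathbb F_{q_1}\times\cdots\times\mathbb F_{q_t}$ (a finite product of finite fields), $\Gamma(R)\subseteq AG(R)\subseteq W\Gamma(R)$.
   Context: $Z(R)$ is the set of zero-divisors of the commutative ring $R$ and $Z(R)^*=Z(R)\setminus\{0\}$. All three graphs are simple graphs with vertex set $Z(R)^*$, and $G\subseteq H$ means $E(G)\subseteq E(H)$ (spanning subgraph). Adjacency for distinct $x,y\in Z(R)^*$: - zero-divisor graph $\Gamma(R)$: $x\sim y$ iff $xy=0$; - (Badawi's) annihilator graph $AG(R)$: $x\sim y$ iff $\operatorname{Ann}(xy)\ne\operatorname{Ann}(x)\cup\operatorname{Ann}(y)$; - weakly zero-divisor graph $W\Gamma(R)$: $x\sim y$ iff there exist nonzero $r\in\operatorname{Ann}(x)$ and nonzero $s\in\operatorname{Ann}(y)$ with $rs=0$. *)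

theory Defs
  imports "HOL-Algebra.Chinese_Remainder" "Graph_Theory.Digraph_Component"
begin

definition reduced_ring :: "('a, 'm) ring_scheme \<Rightarrow> bool" where
  "reduced_ring R \<longleftrightarrow>
     (\<forall>x \<in> carrier R. (\<exists>n::nat. x [^]\<^bsub>R\<^esub> n = \<zero>\<^bsub>R\<^esub>) \<longrightarrow> x = \<zero>\<^bsub>R\<^esub>)"

definition Ann :: "('a, 'm) ring_scheme \<Rightarrow> 'a \<Rightarrow> 'a set" where
  "Ann R x = {r \<in> carrier R. r \<otimes>\<^bsub>R\<^esub> x = \<zero>\<^bsub>R\<^esub>}"

text \<open>Zero counts as a zero-divisor (in a nonzero ring); \<open>Zdiv_star\<close> removes it.\<close>

definition Zdiv :: "('a, 'm) ring_scheme \<Rightarrow> 'a set" where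
  "Zdiv R = {x \<in> carrier R. \<exists>y \<in> carrier R. y \<noteq> \<zero>\<^bsub>R\<^esub> \<and> x \<otimes>\<^bsub>R\<^esub> y = \<zero>\<^bsub>R\<^esub>}"

definition Zdiv_star :: "('a, 'm) ring_scheme \<Rightarrow> 'a set" where
  "Zdiv_star R = Zdiv R - {\<zero>\<^bsub>R\<^esub>}"

text \<open>
  An undirected simple graph is a \<open>pair_pre_digraph\<close> whose arc relation is symmetric and
  irreflexive (on a finite vertex set, the locale \<open>pair_graph\<close>). That the three graphs below
  are of this kind is proved after their definitions.
\<close>

definition zero_divisor_graph :: "('a, 'm) ring_scheme \<Rightarrow> 'a pair_pre_digraph" where
  "zero_divisor_graph R =
     \<lparr> pverts = Zdiv_star R,
       parcs = {(x, y). x \<in> Zdiv_star R \<and> y \<in> Zdiv_star R \<and> x \<noteq> y \<and>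
                        x \<otimes>\<^bsub>R\<^esub> y = \<zero>\<^bsub>R\<^esub>} \<rparr>"

definition annihilator_graph :: "('a, 'm) ring_scheme \<Rightarrow> 'a pair_pre_digraph" where
  "annihilator_graph R =
     \<lparr> pverts = Zdiv_star R,
       parcs = {(x, y). x \<in> Zdiv_star R \<and> y \<in> Zdiv_star R \<and> x \<noteq> y \<and>
                        Ann R (x \<otimes>\<^bsub>R\<^esub> y) \<noteq> Ann R x \<union> Ann R y} \<rparr>"

definition weakly_zero_divisor_graph :: "('a, 'm) ring_scheme \<Rightarrow> 'a pair_pre_digraph" where
  "weakly_zero_divisor_graph R =
     \<lparr> pverts = Zdiv_star R,
       parcs = {(x, y). x \<in> Zdiv_star R \<and> y \<in> Zdiv_star R \<and> x \<noteq> y \<and>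
                        (\<exists>r \<in> Ann R x. \<exists>s \<in> Ann R y.
                           r \<noteq> \<zero>\<^bsub>R\<^esub> \<and> s \<noteq> \<zero>\<^bsub>R\<^esub> \<and> r \<otimes>\<^bsub>R\<^esub> s = \<zero>\<^bsub>R\<^esub>)} \<rparr>"

lemma Zdiv_star_subset: "Zdiv_star R \<subseteq> carrier R"
  by (auto simp: Zdiv_star_def Zdiv_def)

lemma pair_graphI':
  assumes "finite V" "E \<subseteq> V \<times> V" "sym E" "irrefl E"
  shows "pair_graph \<lparr> pverts = V, parcs = E \<rparr>"
proof -
  have "finite E" using assms(1,2) finite_subset by blast
  then show ?thesis
    using assms by unfold_locales (auto simp: irrefl_def symmetric_def arcs_ends_conv)
qed

context
  fixes R :: "('a, 'm) ring_scheme" (structure)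
  assumes R: "cring R" and fin: "finite (carrier R)"
begin

interpretation cring R by (rule R)

lemma finite_Zdiv_star: "finite (Zdiv_star R)"
  by (rule finite_subset[OF Zdiv_star_subset fin])

lemma Zdiv_star_comm:
  assumes "x \<in> Zdiv_star R" "y \<in> Zdiv_star R"
  shows "x \<otimes> y = y \<otimes> x"
  using assms by (intro m_comm) (auto simp: Zdiv_star_def Zdiv_def)

lemma pair_graph_zero_divisor_graph: "pair_graph (zero_divisor_graph R)"
  unfolding zero_divisor_graph_def
  by (rule pair_graphI'[OF finite_Zdiv_star])
     (auto intro!: symI simp: irrefl_def dest: Zdiv_star_comm)

lemma pair_graph_annihilator_graph: "pair_graph (annihilator_graph R)"
  unfolding annihilator_graph_def
proof (rule pair_graphI'[OF finite_Zdiv_star])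
  show "sym {(x, y). x \<in> Zdiv_star R \<and> y \<in> Zdiv_star R \<and> x \<noteq> y \<and>
                     Ann R (x \<otimes> y) \<noteq> Ann R x \<union> Ann R y}"
    by (rule symI) (use Zdiv_star_comm in \<open>simp add: Un_commute, metis\<close>)
qed (auto simp: irrefl_def)

lemma pair_graph_weakly_zero_divisor_graph: "pair_graph (weakly_zero_divisor_graph R)"
  unfolding weakly_zero_divisor_graph_def
proof (rule pair_graphI'[OF finite_Zdiv_star])
  have *: "r \<otimes> s = \<zero> \<Longrightarrow> s \<otimes> r = \<zero>" if "r \<in> Ann R x" "s \<in> Ann R y" for r s x y
    using that m_comm[of r s] by (simp add: Ann_def)
  show "sym {(x, y). x \<in> Zdiv_star R \<and> y \<in> Zdiv_star R \<and> x \<noteq> y \<and>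
                     (\<exists>r \<in> Ann R x. \<exists>s \<in> Ann R y. r \<noteq> \<zero> \<and> s \<noteq> \<zero> \<and> r \<otimes> s = \<zero>)}"
    by (rule symI, simp) (use * in blast)
qed (auto simp: irrefl_def)

end

end

theory Submission
  imports Defs
begin

text \<open>All three graphs share their vertices, so only inclusions of arc sets matter. If
  \<open>x \<otimes> y = \<zero>\<close>, then \<open>\<one>\<close> annihilates the product but
  neither nonzero factor, so the annihilators differ. If \<open>Ann R (x \<otimes> y)\<close>
  differs from the union, some \<open>t\<close> kills the product but neither factor; then
  \<open>t \<otimes> y\<close> and \<open>t \<otimes> x\<close> are nonzero annihilators of
  \<open>x\<close> and \<open>y\<close> with product zero.\<close>

text \<open>\<open>spanning\<close> also demands well-formed digraphs with compatible tail and head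
  maps: \<open>pair_graph\<close> gives the former, and \<open>with_proj\<close> uses the pair
  projections in both graphs.\<close>

lemma spanning_with_projI:
  assumes "pair_graph G" "pair_graph H" "pverts G = pverts H" "parcs G \<subseteq> parcs H"
  shows "spanning (with_proj G) (with_proj H)"
proof -
  interpret G: pair_graph G by fact
  interpret H: pair_graph H by fact
  show ?thesis
    using assms(3,4) G.wf_digraph H.wf_digraph
    unfolding spanning_def subgraph_def compatible_def by simp
qed

lemma (in cring) zero_divisor_graph_subset_annihilator_graph:
  "parcs (zero_divisor_graph R) \<subseteq> parcs (annihilator_graph R)"
proof -
  have "\<one> \<in> Ann R \<zero>"
    by (simp add: Ann_def)
  moreover have "\<one> \<notin> Ann R x" if "x \<in> Zdiv_star R" for x
    using that by (auto simp: Ann_def Zdiv_star_def Zdiv_def)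
  ultimately show ?thesis
    by (auto simp: zero_divisor_graph_def annihilator_graph_def)
qed

lemma (in cring) annihilator_graph_subset_weakly_zero_divisor_graph:
  "parcs (annihilator_graph R) \<subseteq> parcs (weakly_zero_divisor_graph R)"
proof -
  have "\<exists>r \<in> Ann R x. \<exists>s \<in> Ann R y. r \<noteq> \<zero> \<and> s \<noteq> \<zero> \<and> r \<otimes> s = \<zero>"
    if x: "x \<in> carrier R" and y: "y \<in> carrier R"
      and ne: "Ann R (x \<otimes> y) \<noteq> Ann R x \<union> Ann R y" for x y
  proof -
    have Ann_left: "t \<otimes> (x \<otimes> y) = (t \<otimes> x) \<otimes> y"
      and Ann_right: "t \<otimes> (x \<otimes> y) = (t \<otimes> y) \<otimes> x" if "t \<in> carrier R" for t
      using that x y by (simp_all add: m_ac)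
    \<comment> \<open>This inclusion always holds, so \<open>ne\<close> makes it strict and yields
      \<open>t\<close> outside the union. In the case \<open>t \<otimes> y = \<zero>\<close> the
      product is folded back and regrouped by \<open>Ann_right\<close>.\<close>
    have "Ann R x \<union> Ann R y \<subseteq> Ann R (x \<otimes> y)"
      using x y by (auto simp: Ann_def Ann_left) (simp add: Ann_right flip: Ann_left)
    with ne obtain t where t: "t \<in> carrier R" "t \<otimes> (x \<otimes> y) = \<zero>"
      and nz: "t \<otimes> x \<noteq> \<zero>" "t \<otimes> y \<noteq> \<zero>"
      by (auto simp: Ann_def)
    \<comment> \<open>The witnesses are crossed, \<open>r = t \<otimes> y\<close> and
      \<open>s = t \<otimes> x\<close>, so that \<open>r \<otimes> x\<close>,
      \<open>s \<otimes> y\<close> and \<open>r \<otimes> s\<close> all contain the factor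
      \<open>t \<otimes> (x \<otimes> y)\<close>.\<close>
    have "(t \<otimes> y) \<otimes> (t \<otimes> x) = t \<otimes> (t \<otimes> (x \<otimes> y))"
      using t(1) x y by (simp add: m_ac)
    then have "(t \<otimes> y) \<otimes> (t \<otimes> x) = \<zero>"
      using t by simp
    moreover have "t \<otimes> y \<in> Ann R x" "t \<otimes> x \<in> Ann R y"
      using t x y Ann_left[OF t(1)] Ann_right[OF t(1)] by (simp_all add: Ann_def)
    ultimately show ?thesis
      using nz by blast
  qed
  then show ?thesis
    using Zdiv_star_subset[of R]
    by (auto simp: annihilator_graph_def weakly_zero_divisor_graph_def subset_iff)
qed

theorem proposition3p4:
  fixes R :: "('a, 'm) ring_scheme" and Fs :: "'b ring list"
  assumes "cring R" and "finite (carrier R)" and "reduced_ring R"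
    and "\<And>F. F \<in> set Fs \<Longrightarrow> field F \<and> finite (carrier F)"
    and "R \<simeq> RDirProd_list Fs"
  shows "spanning (with_proj (zero_divisor_graph R)) (with_proj (annihilator_graph R)) \<and>
         spanning (with_proj (annihilator_graph R)) (with_proj (weakly_zero_divisor_graph R))"
proof -
  interpret cring R by fact
  note graphs = pair_graph_zero_divisor_graph[OF assms(1,2)]
    pair_graph_annihilator_graph[OF assms(1,2)]
    pair_graph_weakly_zero_divisor_graph[OF assms(1,2)]
  have "pverts (zero_divisor_graph R) = pverts (annihilator_graph R)"
    "pverts (annihilator_graph R) = pverts (weakly_zero_divisor_graph R)"
    by (simp_all add: zero_divisor_graph_def annihilator_graph_def weakly_zero_divisor_graph_def)
  with graphs show ?thesis
    by (simp add: spanning_with_projI zero_divisor_graph_subset_annihilator_graph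
        annihilator_graph_subset_weakly_zero_divisor_graph)
qed

end
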